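(* The single-integrator multi-agent system $\dot p=u$, $y=Cp$, consisting of $m$ agents with positions $p_i\in\mathbb R^2$ and with measurements described by the directed graph $\mathrm G_{\rm o}^+=(\mathcal V\cup\{O\},\mathcal E_{\rm o}\cup\mathcal E_{\rm a})$, is observable if and only if the graph $\overline{\mathrm G}_{\rm o}^+$ is connected, where $\overline{\mathrm G}_{\rm o}^+$ is the undirected graph obtained by dropping the directions of all edges in $\mathrm G_{\rm o}^+$.
   Context: $\mathcal V=\{1,\dots,m\}$, $p=[p_1^\top,\dots,p_m^\top]^\top\in\mathbb R^{2m}$, $u=[u_1^\top,\dots,u_m^\top]^\top\in\mathbb R^{2m}$. $\mathcal E_{\rm o}\subseteq\mathcal V\times\mathcal V$ (no self-loops) is the set of relative position measurements: an edge between agents $i$ and $j$ in $\mathcal E_{\rm o}$ means that one of them (the end node of the edge) measures the difference of their positions. $\mathcal E_{\rm a}\subseteq\{O\}\times\mathcal V$ is the set of absolute position measurements: $(O,k)\in\mathcal E_{\rm a}$ means that agent $k$ measures its absolute position relative to the origin $O$ of the global reference frame. With $q_{\rm o}=|\mathcal E_{\rm o}|$, $q_{\rm a}=|\mathcal E_{\rm a}|$, $q=q_{\rm o}+q_{\rm a}$, the observation matrix is (up to row permutation) $C=\begin{bmatrix}C_{\rm o}\\C_{\rm a}\end{bmatrix}\in\mathbb R^{2q\times2m}$. Each edge of $\mathcal E_{\rm o}$ between agents $i<j$ contributes to $C_{\rm o}\in\mathbb R^{2q_{\rm o}\times2m}$ two rows, forming a $2\times2m$ block with $I_2$ in columns $2i-1,2i$,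 $-I_2$ in columns $2j-1,2j$ and zeros elsewhere. Each edge $(O,k)\in\mathcal E_{\rm a}$ contributes to $C_{\rm a}\in\mathbb R^{2q_{\rm a}\times2m}$ two rows, forming a $2\times2m$ block with $-I_2$ in columns $2k-1,2k$ and zeros elsewhere. The system matrix of the system is $A=0_{2m\times2m}$, and observability means the usual observability of the pair $(A,C)$. *)

theory Defs
  imports
    Complex_Main
    "HOL-Combinatorics.Permutations"
    "Jordan_Normal_Form.Matrix"
    "Graph_Theory.Digraph_Component"
begin

section \<open>Observability of linear time-invariant systems\<close>

text \<open>
  A solution of \<open>x' = A x + B u\<close> on \<open>[0, T]\<close>.  Vectors carry no topology here, so the
  differential equation is stated componentwise; derivatives at the end points are one-sided.
\<close>

definition lti_solution ::
    "real mat \<Rightarrow> real mat \<Rightarrow> (real \<Rightarrow> real vec) \<Rightarrow> real \<Rightarrow> (real \<Rightarrow> real vec) \<Rightarrow> bool" where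
  "lti_solution A B u T x \<longleftrightarrow>
     (\<forall>t\<in>{0..T}. u t \<in> carrier_vec (dim_col B) \<and> x t \<in> carrier_vec (dim_row A) \<and>
       (\<forall>i<dim_row A. ((\<lambda>s. x s $ i) has_real_derivative
          (A *\<^sub>v x t + B *\<^sub>v u t) $ i) (at t within {0..T})))"

text \<open>
  The system \<open>x' = A x + B u\<close>, \<open>y = C x\<close> is observable if, for some finite horizon \<open>T\<close>, the
  input and the output on \<open>[0, T]\<close> determine the initial state.
\<close>

definition observable_system :: "real mat \<Rightarrow> real mat \<Rightarrow> real mat \<Rightarrow> bool" where
  "observable_system A B C \<longleftrightarrow>
     (\<exists>T>0. \<forall>u x x'. lti_solution A B u T x \<longrightarrow> lti_solution A B u T x' \<longrightarrow>
        (\<forall>t\<in>{0..T}. C *\<^sub>v x t = C *\<^sub>v x' t) \<longrightarrow> x 0 = x' 0)"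

text \<open>Observability does not depend on \<open>B\<close>: it is a property of the pair \<open>(A, C)\<close>.\<close>

lemma observable_system_change_input:
  assumes A: "A \<in> carrier_mat n n" and B: "B \<in> carrier_mat n k" and B': "B' \<in> carrier_mat n l"
    and C: "C \<in> carrier_mat r n" and obs: "observable_system A B C"
  shows "observable_system A B' C"
proof -
  obtain T where T: "T > 0" and det: "\<And>u x x'. lti_solution A B u T x \<Longrightarrow>
      lti_solution A B u T x' \<Longrightarrow> (\<forall>t\<in>{0..T}. C *\<^sub>v x t = C *\<^sub>v x' t) \<Longrightarrow> x 0 = x' 0"
    using obs unfolding observable_system_def by blast
  have dims: "dim_row A = n" "dim_col A = n" "dim_row B = n" "dim_col B = k"
    "dim_row B' = n" "dim_col B' = l" using A B B' by auto
  have "x 0 = x' 0"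
    if x: "lti_solution A B' u T x" and x': "lti_solution A B' u T x'"
      and y: "\<forall>t\<in>{0..T}. C *\<^sub>v x t = C *\<^sub>v x' t" for u x x'
  proof -
    define d where "d = (\<lambda>t. x t - x' t)"
    have cx: "x t \<in> carrier_vec n" "x' t \<in> carrier_vec n" "u t \<in> carrier_vec l"
      if "t \<in> {0..T}" for t
      using x x' that unfolding lti_solution_def dims by auto
    have B0: "B *\<^sub>v 0\<^sub>v k = 0\<^sub>v n"
      using B by (intro eq_vecI) auto
    have A0: "A *\<^sub>v 0\<^sub>v n = 0\<^sub>v n"
      using A by (intro eq_vecI) auto
    have sol_d: "lti_solution A B (\<lambda>_. 0\<^sub>v k) T d"
      unfolding lti_solution_def dims
    proof (intro ballI conjI allI impI)
      fix t assume t: "t \<in> {0..T}"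
      show "0\<^sub>v k \<in> carrier_vec k" by simp
      show "d t \<in> carrier_vec n" using cx[OF t] unfolding d_def by auto
      fix i assume i: "i < n"
      have "((\<lambda>s. x s $ i - x' s $ i) has_real_derivative
          (A *\<^sub>v x t + B' *\<^sub>v u t) $ i - (A *\<^sub>v x' t + B' *\<^sub>v u t) $ i) (at t within {0..T})"
        using x x' t i unfolding lti_solution_def dims by (intro DERIV_diff) auto
      moreover have "(A *\<^sub>v x t + B' *\<^sub>v u t) $ i - (A *\<^sub>v x' t + B' *\<^sub>v u t) $ i
          = (A *\<^sub>v d t + B *\<^sub>v 0\<^sub>v k) $ i"
        using cx[OF t] A B' i
        by (simp add: B0 d_def mult_minus_distrib_mat_vec[OF A])
      ultimately have deriv: "((\<lambda>s. x s $ i - x' s $ i) has_real_derivative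
          (A *\<^sub>v d t + B *\<^sub>v 0\<^sub>v k) $ i) (at t within {0..T})" by simp
      have eq: "x s $ i - x' s $ i = d s $ i" if "s \<in> {0..T}" for s
        using cx[OF that] i by (simp add: d_def)
      show "((\<lambda>s. d s $ i) has_real_derivative
          (A *\<^sub>v d t + B *\<^sub>v 0\<^sub>v k) $ i) (at t within {0..T})"
        using has_derivative_transform[OF t _ deriv[unfolded has_field_derivative_def]] eq
        unfolding has_field_derivative_def by simp
    qed
    have sol_0: "lti_solution A B (\<lambda>_. 0\<^sub>v k) T (\<lambda>_. 0\<^sub>v n)"
      unfolding lti_solution_def dims by (simp add: A0 B0)
    have "C *\<^sub>v d t = C *\<^sub>v 0\<^sub>v n" if t: "t \<in> {0..T}" for t
    proof -
      have "C *\<^sub>v d t = C *\<^sub>v x t - C *\<^sub>v x' t"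
        unfolding d_def using cx[OF t] by (simp add: mult_minus_distrib_mat_vec[OF C])
      also have "\<dots> = C *\<^sub>v 0\<^sub>v n"
      proof -
        have "C *\<^sub>v x t = C *\<^sub>v x' t" using y t by blast
        moreover have "C *\<^sub>v 0\<^sub>v n = 0\<^sub>v r" using C by (intro eq_vecI) auto
        ultimately show ?thesis using C by (intro eq_vecI) simp_all
      qed
      finally show ?thesis .
    qed
    then have "d 0 = 0\<^sub>v n"
      using det[OF sol_d sol_0] by blast
    then have d0: "d 0 $ i = 0" if "i < n" for i
      using that by simp
    have c0: "x 0 \<in> carrier_vec n" "x' 0 \<in> carrier_vec n"
      using cx[of 0] T by auto
    have "x 0 $ i = x' 0 $ i" if "i < n" for i
      using d0[OF that] c0 that by (simp add: d_def)
    then show ?thesis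
      using c0 by (intro eq_vecI) auto
  qed
  then show ?thesis
    unfolding observable_system_def using T by blast
qed

section \<open>Measurement graph and observation matrix\<close>

text \<open>
  Agents are \<open>1, \<dots>, m\<close>; the origin \<open>O\<close> of the global frame is encoded as the node \<open>0\<close>.
  Connectedness of this digraph in the sense of \<open>Digraph_Component.connected\<close> already refers to its
  symmetrization \<open>mk_symmetric\<close>, i.e. to the graph with the edge directions dropped.
\<close>

definition agents :: "nat \<Rightarrow> nat set" where
  "agents m = {1..m}"

definition origin :: nat where
  "origin = 0"

definition measurement_graph ::
    "nat \<Rightarrow> (nat \<times> nat) set \<Rightarrow> (nat \<times> nat) set \<Rightarrow> nat pair_pre_digraph" where
  "measurement_graph m Eo Ea = \<lparr>pverts = agents m \<union> {origin}, parcs = Eo \<union> Ea\<rparr>"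

text \<open>
  Matrix indices start at 0, so the columns of agent \<open>i\<close> are \<open>2 * (i - 1)\<close> and
  \<open>2 * (i - 1) + 1\<close>.  The sign in a relative block depends on which agent has the smaller index,
  not on the direction of the edge.
\<close>

definition relative_block :: "nat \<Rightarrow> nat \<times> nat \<Rightarrow> real mat" where
  "relative_block m e =
     (let i = min (fst e) (snd e); j = max (fst e) (snd e) in
      mat 2 (2 * m) (\<lambda>(r, c). if c = 2 * (i - 1) + r then 1
                              else if c = 2 * (j - 1) + r then -1 else 0))"

definition absolute_block :: "nat \<Rightarrow> nat \<times> nat \<Rightarrow> real mat" where
  "absolute_block m e =
     (let k = snd e in mat 2 (2 * m) (\<lambda>(r, c). if c = 2 * (k - 1) + r then -1 else 0))"

definition stack_blocks :: "nat \<Rightarrow> real mat list \<Rightarrow> real mat" where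
  "stack_blocks nc Ms = foldr (\<lambda>M N. M @\<^sub>r N) Ms (0\<^sub>m 0 nc)"

definition permute_rows :: "(nat \<Rightarrow> nat) \<Rightarrow> real mat \<Rightarrow> real mat" where
  "permute_rows \<pi> M = mat (dim_row M) (dim_col M) (\<lambda>(i, j). M $$ (\<pi> i, j))"

text \<open>
  The observation matrix is only determined up to a permutation of its rows, hence a predicate.
\<close>

definition is_observation_matrix ::
    "nat \<Rightarrow> (nat \<times> nat) set \<Rightarrow> (nat \<times> nat) set \<Rightarrow> real mat \<Rightarrow> bool" where
  "is_observation_matrix m Eo Ea C \<longleftrightarrow>
     (\<exists>es ks \<pi>. distinct es \<and> set es = Eo \<and> distinct ks \<and> set ks = Ea \<and>
        \<pi> permutes {..<2 * (card Eo + card Ea)} \<and>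
        C = permute_rows \<pi> (stack_blocks (2 * m) (map (relative_block m) es) @\<^sub>r
                            stack_blocks (2 * m) (map (absolute_block m) ks)))"

lemma stack_blocks_carrier:
  assumes "\<forall>M\<in>set Ms. M \<in> carrier_mat 2 nc"
  shows "stack_blocks nc Ms \<in> carrier_mat (2 * length Ms) nc"
  using assms
proof (induction Ms)
  case Nil
  then show ?case by (simp add: stack_blocks_def)
next
  case (Cons M Ms)
  then have "M @\<^sub>r stack_blocks nc Ms \<in> carrier_mat (2 + 2 * length Ms) nc"
    by (intro carrier_append_rows) auto
  then show ?case by (simp add: stack_blocks_def)
qed

lemma is_observation_matrix_carrier:
  assumes "is_observation_matrix m Eo Ea C"
  shows "C \<in> carrier_mat (2 * (card Eo + card Ea)) (2 * m)"
proof -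
  obtain es ks \<pi> where l: "distinct es" "set es = Eo" "distinct ks" "set ks = Ea"
    and C: "C = permute_rows \<pi> (stack_blocks (2 * m) (map (relative_block m) es) @\<^sub>r
                            stack_blocks (2 * m) (map (absolute_block m) ks))"
    using assms unfolding is_observation_matrix_def by blast
  have "stack_blocks (2 * m) (map (relative_block m) es) \<in> carrier_mat (2 * card Eo) (2 * m)"
    using stack_blocks_carrier[of "map (relative_block m) es" "2 * m"] l distinct_card[of es]
    by (auto simp: relative_block_def Let_def)
  moreover have "stack_blocks (2 * m) (map (absolute_block m) ks) \<in> carrier_mat (2 * card Ea) (2 * m)"
    using stack_blocks_carrier[of "map (absolute_block m) ks" "2 * m"] l distinct_card[of ks]
    by (auto simp: absolute_block_def Let_def)
  ultimately have "stack_blocks (2 * m) (map (relative_block m) es) @\<^sub>r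
      stack_blocks (2 * m) (map (absolute_block m) ks)
      \<in> carrier_mat (2 * card Eo + 2 * card Ea) (2 * m)"
    by (rule carrier_append_rows)
  then show ?thesis
    unfolding C permute_rows_def by (metis (no_types, lifting) carrier_matD distrib_left mat_carrier)
qed

lemma is_observation_matrix_exists:
  assumes "finite Eo" "finite Ea"
  shows "\<exists>C. is_observation_matrix m Eo Ea C"
proof -
  obtain es ks where l: "distinct es" "set es = Eo" "distinct ks" "set ks = Ea"
    using finite_distinct_list[OF assms(1)] finite_distinct_list[OF assms(2)] by blast
  show ?thesis
    unfolding is_observation_matrix_def
    by (rule exI, rule exI[of _ es], rule exI[of _ ks], rule exI[of _ id])
      (intro conjI permutes_id l, rule refl)
qed

end

theory Submission
  imports Defs
begin

text \<open>
  Since the state matrix vanishes and the input is known, the difference of two solutions is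
  constant, so observability says that \<open>C\<close> has trivial kernel.  Extend \<open>v\<close> by the value \<open>0\<close> at the
  origin; then \<open>C v = 0\<close> says that each coordinate of \<open>v\<close> is constant along every edge of
  the measurement graph.  Such a function vanishes for every choice of \<open>v\<close> precisely when every agent
  can be reached from the origin by an undirected path: in the other direction, the indicator
  function of the agents that cannot be reached is a nonzero kernel vector.
\<close>

section \<open>Observability as triviality of a kernel\<close>

lemma observable_zero_system_iff:
  assumes C: "C \<in> carrier_mat k n"
  shows "observable_system (0\<^sub>m n n) (1\<^sub>m n) C \<longleftrightarrow>
    (\<forall>v\<in>carrier_vec n. C *\<^sub>v v = 0\<^sub>v k \<longrightarrow> v = 0\<^sub>v n)"
proof
  assume "observable_system (0\<^sub>m n n) (1\<^sub>m n) C"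
  then obtain T where det: "\<And>u x x'. lti_solution (0\<^sub>m n n) (1\<^sub>m n) u T x \<Longrightarrow>
      lti_solution (0\<^sub>m n n) (1\<^sub>m n) u T x' \<Longrightarrow> (\<forall>t\<in>{0..T}. C *\<^sub>v x t = C *\<^sub>v x' t) \<Longrightarrow> x 0 = x' 0"
    unfolding observable_system_def by blast
  \<comment> \<open>Under zero input every constant trajectory is a solution, so a kernel vector and
    the zero vector give rise to the same output.\<close>
  have const: "lti_solution (0\<^sub>m n n) (1\<^sub>m n) (\<lambda>_. 0\<^sub>v n) T (\<lambda>_. w)" if "w \<in> carrier_vec n" for w
    using that unfolding lti_solution_def by simp
  have C0: "C *\<^sub>v 0\<^sub>v n = 0\<^sub>v k"
    using C by (intro eq_vecI) auto
  show "\<forall>v\<in>carrier_vec n. C *\<^sub>v v = 0\<^sub>v k \<longrightarrow> v = 0\<^sub>v n"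
    using det[OF const const] C0 by simp
next
  assume ker: "\<forall>v\<in>carrier_vec n. C *\<^sub>v v = 0\<^sub>v k \<longrightarrow> v = 0\<^sub>v n"
  \<comment> \<open>The horizon 1 is an arbitrary positive choice: once the kernel is trivial, the
    output at time 0 alone fixes the initial state.\<close>
  have "x 0 = x' 0"
    if x: "lti_solution (0\<^sub>m n n) (1\<^sub>m n) u 1 x" and x': "lti_solution (0\<^sub>m n n) (1\<^sub>m n) u 1 x'"
      and y: "\<forall>t\<in>{0..1}. C *\<^sub>v x t = C *\<^sub>v x' t" for u x x'
  proof -
    have c: "x 0 \<in> carrier_vec n" "x' 0 \<in> carrier_vec n"
      using x x' unfolding lti_solution_def by auto
    then have "C *\<^sub>v (x 0 - x' 0) = C *\<^sub>v x 0 - C *\<^sub>v x' 0"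
      by (simp add: mult_minus_distrib_mat_vec[OF C])
    also have "\<dots> = 0\<^sub>v k"
      using y C c by simp
    finally have d: "x 0 - x' 0 = 0\<^sub>v n"
      using ker c by simp
    show ?thesis
    proof (rule eq_vecI)
      fix i assume "i < dim_vec (x' 0)"
      then have i: "i < n" using c by simp
      then have "(x 0 - x' 0) $ i = 0" by (simp add: d)
      then show "x 0 $ i = x' 0 $ i" using c i by simp
    qed (use c in simp)
  qed
  then show "observable_system (0\<^sub>m n n) (1\<^sub>m n) C"
    unfolding observable_system_def by (intro exI[of _ 1]) auto
qed

section \<open>Connectedness tested by real functions on the nodes\<close>

lemma (in wf_digraph) connected_iff_constant_along_arcs:
  assumes r: "r \<in> verts G"
  shows "connected G \<longleftrightarrow>
    (\<forall>f :: 'a \<Rightarrow> real. f r = 0 \<longrightarrow> (\<forall>e\<in>arcs G. f (tail G e) = f (head G e)) \<longrightarrow>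
      (\<forall>v\<in>verts G. f v = 0))"
proof -
  interpret S: pair_wf_digraph "mk_symmetric G" ..
  show ?thesis
  proof (intro iffI allI impI ballI)
    fix f :: "'a \<Rightarrow> real" and v
    assume "connected G" and f: "f r = 0" "\<forall>e\<in>arcs G. f (tail G e) = f (head G e)"
      and v: "v \<in> verts G"
    then have "r \<rightarrow>\<^sup>*\<^bsub>mk_symmetric G\<^esub> v"
      using r by (auto simp: connected_def)
    then show "f v = 0"
      by (induction rule: S.reachable_induct) (use f in \<open>auto simp: parcs_mk_symmetric\<close>)
  next
    assume all: "\<forall>f :: 'a \<Rightarrow> real. f r = 0 \<longrightarrow> (\<forall>e\<in>arcs G. f (tail G e) = f (head G e)) \<longrightarrow>
      (\<forall>v\<in>verts G. f v = 0)"
    define f :: "'a \<Rightarrow> real" where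
      "f = (\<lambda>v. if r \<rightarrow>\<^sup>*\<^bsub>mk_symmetric G\<^esub> v then 0 else 1)"
    have "f (tail G e) = f (head G e)" if "e \<in> arcs G" for e
    proof -
      \<comment> \<open>Symmetrization supplies both directions of \<open>e\<close>, so its ends are
        either both reachable from \<open>r\<close> or both unreachable.\<close>
      have "tail G e \<rightarrow>\<^bsub>mk_symmetric G\<^esub> head G e" "head G e \<rightarrow>\<^bsub>mk_symmetric G\<^esub> tail G e"
        using that by (auto simp: parcs_mk_symmetric)
      then show ?thesis
        unfolding f_def by (auto dest: S.reachable_adj_trans)
    qed
    moreover have "f r = 0"
      unfolding f_def using r by simp
    ultimately have "\<forall>v\<in>verts G. f v = 0"
      using all by blast
    then have reach: "r \<rightarrow>\<^sup>*\<^bsub>mk_symmetric G\<^esub> v" if "v \<in> verts G" for v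
      using that by (auto simp: f_def split: if_splits)
    show "connected G"
      unfolding connected_def
    proof (rule strongly_connectedI)
      show "verts (mk_symmetric G) \<noteq> {}"
        using r by auto
      \<comment> \<open>The walk from \<open>u\<close> to \<open>v\<close> passes through
        \<open>r\<close>; its first half is the reversal of a walk from \<open>r\<close> to
        \<open>u\<close>.\<close>
      fix u v assume "u \<in> verts (mk_symmetric G)" "v \<in> verts (mk_symmetric G)"
      then show "u \<rightarrow>\<^sup>*\<^bsub>mk_symmetric G\<^esub> v"
        using reach[of u] reach[of v] symmetric_reachable[OF symmetric_mk_symmetric]
        by (metis S.reachable_trans pverts_mk_symmetric with_proj_simps(1))
    qed
  qed
qed

section \<open>Kernels of stacked and row-permuted matrices\<close>

lemma stack_blocks_mult_eq_0_iff:
  assumes "\<forall>M\<in>set Ms. M \<in> carrier_mat 2 nc" and v: "v \<in> carrier_vec nc"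
  shows "stack_blocks nc Ms *\<^sub>v v = 0\<^sub>v (2 * length Ms) \<longleftrightarrow> (\<forall>M\<in>set Ms. M *\<^sub>v v = 0\<^sub>v 2)"
  using assms(1)
proof (induction Ms)
  case Nil
  then show ?case
    by (auto simp: stack_blocks_def intro: eq_vecI)
next
  case (Cons M Ms)
  have M: "M \<in> carrier_mat 2 nc" and S: "stack_blocks nc Ms \<in> carrier_mat (2 * length Ms) nc"
    using Cons.prems stack_blocks_carrier[of Ms nc] by auto
  have zero: "0\<^sub>v (2 * length (M # Ms)) = 0\<^sub>v 2 @\<^sub>v (0\<^sub>v (2 * length Ms) :: real vec)"
    by (intro eq_vecI) auto
  have "stack_blocks nc (M # Ms) *\<^sub>v v = M *\<^sub>v v @\<^sub>v stack_blocks nc Ms *\<^sub>v v"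
    using mat_mult_append[OF M S v] by (simp add: stack_blocks_def)
  moreover have "M *\<^sub>v v \<in> carrier_vec 2"
    using M v by simp
  ultimately show ?case
    using Cons append_vec_eq[of "M *\<^sub>v v" 2 "0\<^sub>v 2"] unfolding zero by simp
qed

text \<open>Permuting the rows of \<open>M\<close> only permutes the entries of the product, and
  \<open>\<pi>\<close> maps the index set onto itself. Hence the freedom in ordering the rows of
  \<open>C\<close> does not affect its kernel.\<close>

lemma permute_rows_mult_eq_0_iff:
  assumes M: "M \<in> carrier_mat k n" and \<pi>: "\<pi> permutes {..<k}" and v: "v \<in> carrier_vec n"
  shows "permute_rows \<pi> M *\<^sub>v v = 0\<^sub>v k \<longleftrightarrow> M *\<^sub>v v = 0\<^sub>v k"
proof -
  have lt: "\<pi> i < k" if "i < k" for i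
    using permutes_in_image[OF \<pi>] that by auto
  have entry: "(permute_rows \<pi> M *\<^sub>v v) $ i = (M *\<^sub>v v) $ \<pi> i" if "i < k" for i
    using that lt[OF that] M v by (simp add: permute_rows_def scalar_prod_def)
  have "permute_rows \<pi> M *\<^sub>v v = 0\<^sub>v k \<longleftrightarrow> (\<forall>i<k. (permute_rows \<pi> M *\<^sub>v v) $ i = 0)"
    using M by (auto simp: vec_eq_iff permute_rows_def)
  also have "\<dots> \<longleftrightarrow> (\<forall>i\<in>{..<k}. (M *\<^sub>v v) $ \<pi> i = 0)"
    using entry by auto
  also have "\<dots> \<longleftrightarrow> (\<forall>i\<in>\<pi> ` {..<k}. (M *\<^sub>v v) $ i = 0)"
    by blast
  also have "\<dots> \<longleftrightarrow> M *\<^sub>v v = 0\<^sub>v k"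
    using M unfolding permutes_image[OF \<pi>] by (auto simp: vec_eq_iff)
  finally show ?thesis .
qed

section \<open>Measurements as equalities along edges\<close>

text \<open>With value 0 at the origin, relative and absolute measurements both become equalities
  between the two ends of an edge. The case distinction matters: by truncated subtraction, the index
  formula at node 0 would read the entry of agent 1.\<close>

definition node_coord :: "real vec \<Rightarrow> nat \<Rightarrow> nat \<Rightarrow> real" where
  "node_coord v r k = (if k = origin then 0 else v $ (2 * (k - 1) + r))"

text \<open>Row \<open>r\<close> computes a difference of coordinates of the two agents. Sorting
  them by index affects only its sign, hence not whether it vanishes.\<close>

lemma relative_block_mult_eq_0_iff:
  assumes e: "e \<in> agents m \<times> agents m" "fst e \<noteq> snd e" and v: "v \<in> carrier_vec (2 * m)"
  shows "relative_block m e *\<^sub>v v = 0\<^sub>v 2 \<longleftrightarrow>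
    (\<forall>r<2. node_coord v r (fst e) = node_coord v r (snd e))"
proof -
  define i j where "i = min (fst e) (snd e)" and "j = max (fst e) (snd e)"
  have ij: "1 \<le> i" "i < j" "j \<le> m"
    using e unfolding i_def j_def agents_def by auto
  have entry: "(relative_block m e *\<^sub>v v) $ r = v $ (2 * (i - 1) + r) - v $ (2 * (j - 1) + r)"
    if r: "r < 2" for r
  proof -
    have "(relative_block m e *\<^sub>v v) $ r =
        (\<Sum>c<2 * m. (if c = 2 * (i - 1) + r then 1 else if c = 2 * (j - 1) + r then -1 else 0) * v $ c)"
      using r v by (simp add: relative_block_def Let_def scalar_prod_def lessThan_atLeast0
          flip: i_def j_def)
    \<comment> \<open>The nested conditional splits into two independent terms because
      \<open>i < j\<close> keeps the two columns distinct; this is where self-loops are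
      excluded.\<close>
    also have "\<dots> = (\<Sum>c<2 * m. (if c = 2 * (i - 1) + r then v $ c else 0) -
        (if c = 2 * (j - 1) + r then v $ c else 0))"
      using ij by (intro sum.cong) auto
    also have "\<dots> = v $ (2 * (i - 1) + r) - v $ (2 * (j - 1) + r)"
    proof -
      have "2 * (i - 1) + r < 2 * m" "2 * (j - 1) + r < 2 * m"
        using ij r by linarith+
      then show ?thesis
        by (simp add: sum_subtractf)
    qed
    finally show ?thesis .
  qed
  have "relative_block m e *\<^sub>v v = 0\<^sub>v 2 \<longleftrightarrow> (\<forall>r<2. (relative_block m e *\<^sub>v v) $ r = 0)"
    by (auto simp: vec_eq_iff relative_block_def Let_def)
  also have "\<dots> \<longleftrightarrow> (\<forall>r<2. node_coord v r i = node_coord v r j)"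
    using entry ij by (simp add: node_coord_def origin_def)
  also have "\<dots> \<longleftrightarrow> (\<forall>r<2. node_coord v r (fst e) = node_coord v r (snd e))"
    unfolding i_def j_def min_def max_def by auto
  finally show ?thesis .
qed

text \<open>Row \<open>r\<close> computes the negated coordinate of the agent, and the other end of
  the edge has coordinate 0 by the convention in \<open>node_coord\<close>.\<close>

lemma absolute_block_mult_eq_0_iff:
  assumes e: "e \<in> {origin} \<times> agents m" and v: "v \<in> carrier_vec (2 * m)"
  shows "absolute_block m e *\<^sub>v v = 0\<^sub>v 2 \<longleftrightarrow>
    (\<forall>r<2. node_coord v r (fst e) = node_coord v r (snd e))"
proof -
  have k: "1 \<le> snd e" "snd e \<le> m" "fst e = origin"
    using e unfolding agents_def by auto
  have entry: "(absolute_block m e *\<^sub>v v) $ r = - v $ (2 * (snd e - 1) + r)" if r: "r < 2" for r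
  proof -
    have "(absolute_block m e *\<^sub>v v) $ r =
        (\<Sum>c<2 * m. (if c = 2 * (snd e - 1) + r then -1 else 0) * v $ c)"
      using r v by (simp add: absolute_block_def Let_def scalar_prod_def lessThan_atLeast0)
    also have "\<dots> = (\<Sum>c<2 * m. if c = 2 * (snd e - 1) + r then - v $ c else 0)"
      by (intro sum.cong) auto
    also have "\<dots> = - v $ (2 * (snd e - 1) + r)"
    proof -
      have "2 * (snd e - 1) + r < 2 * m"
        using k r by linarith
      then show ?thesis
        by simp
    qed
    finally show ?thesis .
  qed
  have "absolute_block m e *\<^sub>v v = 0\<^sub>v 2 \<longleftrightarrow> (\<forall>r<2. (absolute_block m e *\<^sub>v v) $ r = 0)"
    by (auto simp: vec_eq_iff absolute_block_def Let_def)
  also have "\<dots> \<longleftrightarrow> (\<forall>r<2. node_coord v r (fst e) = node_coord v r (snd e))"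
    using entry k by (simp add: node_coord_def origin_def)
  finally show ?thesis .
qed

lemma observation_matrix_mult_eq_0_iff:
  assumes Eo: "Eo \<subseteq> agents m \<times> agents m" "\<And>i. (i, i) \<notin> Eo"
    and Ea: "Ea \<subseteq> {origin} \<times> agents m"
    and C: "is_observation_matrix m Eo Ea C" and v: "v \<in> carrier_vec (2 * m)"
  shows "C *\<^sub>v v = 0\<^sub>v (2 * (card Eo + card Ea)) \<longleftrightarrow>
    (\<forall>e\<in>Eo \<union> Ea. \<forall>r<2. node_coord v r (fst e) = node_coord v r (snd e))"
proof -
  obtain es ks \<pi> where es: "distinct es" "set es = Eo" and ks: "distinct ks" "set ks = Ea"
    and \<pi>: "\<pi> permutes {..<2 * (card Eo + card Ea)}"
    and C_eq: "C = permute_rows \<pi> (stack_blocks (2 * m) (map (relative_block m) es) @\<^sub>r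
                            stack_blocks (2 * m) (map (absolute_block m) ks))"
    using C unfolding is_observation_matrix_def by blast
  define Mo where "Mo = stack_blocks (2 * m) (map (relative_block m) es)"
  define Ma where "Ma = stack_blocks (2 * m) (map (absolute_block m) ks)"
  have len: "length es = card Eo" "length ks = card Ea"
    using es ks distinct_card by metis+
  have rel: "\<forall>M\<in>set (map (relative_block m) es). M \<in> carrier_mat 2 (2 * m)"
    and abs: "\<forall>M\<in>set (map (absolute_block m) ks). M \<in> carrier_mat 2 (2 * m)"
    by (auto simp: relative_block_def absolute_block_def Let_def)
  have Mo: "Mo \<in> carrier_mat (2 * card Eo) (2 * m)" and Ma: "Ma \<in> carrier_mat (2 * card Ea) (2 * m)"
    using stack_blocks_carrier[OF rel] stack_blocks_carrier[OF abs]
    by (simp_all add: Mo_def Ma_def len)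
  \<comment> \<open>The zero vector is cut at the boundary between the relative and the absolute
    rows, so that the two parts can be compared separately.\<close>
  have zero: "0\<^sub>v (2 * (card Eo + card Ea)) = 0\<^sub>v (2 * card Eo) @\<^sub>v (0\<^sub>v (2 * card Ea) :: real vec)"
    by (intro eq_vecI) auto
  have "C *\<^sub>v v = 0\<^sub>v (2 * (card Eo + card Ea)) \<longleftrightarrow>
      (Mo @\<^sub>r Ma) *\<^sub>v v = 0\<^sub>v (2 * (card Eo + card Ea))"
    unfolding C_eq Mo_def[symmetric] Ma_def[symmetric]
    by (rule permute_rows_mult_eq_0_iff[OF _ \<pi> v]) (use carrier_append_rows[OF Mo Ma] in simp)
  also have "\<dots> \<longleftrightarrow> Mo *\<^sub>v v = 0\<^sub>v (2 * card Eo) \<and> Ma *\<^sub>v v = 0\<^sub>v (2 * card Ea)"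
    unfolding zero mat_mult_append[OF Mo Ma v]
    by (rule append_vec_eq[of _ "2 * card Eo"]) (use Mo v in auto)
  also have "\<dots> \<longleftrightarrow> (\<forall>e\<in>Eo. relative_block m e *\<^sub>v v = 0\<^sub>v 2) \<and>
      (\<forall>e\<in>Ea. absolute_block m e *\<^sub>v v = 0\<^sub>v 2)"
    using stack_blocks_mult_eq_0_iff[OF rel v] stack_blocks_mult_eq_0_iff[OF abs v]
    by (simp add: Mo_def Ma_def len es ks)
  also have "\<dots> \<longleftrightarrow> (\<forall>e\<in>Eo \<union> Ea. \<forall>r<2. node_coord v r (fst e) = node_coord v r (snd e))"
  proof -
    have "relative_block m e *\<^sub>v v = 0\<^sub>v 2 \<longleftrightarrow>
        (\<forall>r<2. node_coord v r (fst e) = node_coord v r (snd e))" if "e \<in> Eo" for e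
      using that Eo by (cases e) (intro relative_block_mult_eq_0_iff v, auto)
    moreover have "absolute_block m e *\<^sub>v v = 0\<^sub>v 2 \<longleftrightarrow>
        (\<forall>r<2. node_coord v r (fst e) = node_coord v r (snd e))" if "e \<in> Ea" for e
      using that Ea by (intro absolute_block_mult_eq_0_iff v) auto
    ultimately show ?thesis by blast
  qed
  finally show ?thesis .
qed

lemma eq_0_iff_node_coord:
  assumes v: "v \<in> carrier_vec (2 * m)"
  shows "v = 0\<^sub>v (2 * m) \<longleftrightarrow> (\<forall>r<2. \<forall>k\<in>agents m. node_coord v r k = 0)"
proof
  assume "v = 0\<^sub>v (2 * m)"
  then show "\<forall>r<2. \<forall>k\<in>agents m. node_coord v r k = 0"
    by (auto simp: node_coord_def agents_def)
next
  assume z: "\<forall>r<2. \<forall>k\<in>agents m. node_coord v r k = 0"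
  show "v = 0\<^sub>v (2 * m)"
  proof (rule eq_vecI)
    fix c assume "c < dim_vec (0\<^sub>v (2 * m) :: real vec)"
    then have c: "c < 2 * m" by simp
    \<comment> \<open>Column \<open>c\<close> holds coordinate \<open>c mod 2\<close> of agent
      \<open>c div 2 + 1\<close>, since agents are numbered from 1 and columns from 0.\<close>
    then have "c div 2 + 1 \<in> agents m" by (auto simp: agents_def)
    then have "node_coord v (c mod 2) (c div 2 + 1) = 0" using z by simp
    then show "v $ c = 0\<^sub>v (2 * m) $ c" using c by (simp add: node_coord_def origin_def)
  qed (use v in simp)
qed

section \<open>Transfer between kernel vectors and node functions\<close>

theorem proposition1:
  fixes m :: nat and Eo Ea :: "(nat \<times> nat) set" and C :: "real mat"
  assumes "Eo \<subseteq> agents m \<times> agents m"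
    and "\<And>i. (i, i) \<notin> Eo"
    and "Ea \<subseteq> {origin} \<times> agents m"
    and "is_observation_matrix m Eo Ea C"
  shows "observable_system (0\<^sub>m (2 * m) (2 * m)) (1\<^sub>m (2 * m)) C \<longleftrightarrow>
         Digraph_Component.connected (measurement_graph m Eo Ea)"
proof -
  let ?G = "measurement_graph m Eo Ea"
  let ?const = "\<lambda>f :: nat \<Rightarrow> real. \<forall>e\<in>Eo \<union> Ea. f (fst e) = f (snd e)"
  interpret G: pair_wf_digraph ?G
    by unfold_locales (use assms(1,3) in \<open>auto simp: measurement_graph_def\<close>)
  \<comment> \<open>The root is the origin, where \<open>f\<close> vanishes by assumption, so only
    the agents remain in the conclusion.\<close>
  have conn: "Digraph_Component.connected ?G \<longleftrightarrow>
      (\<forall>f. f origin = 0 \<longrightarrow> ?const f \<longrightarrow> (\<forall>k\<in>agents m. f k = 0))"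
    by (subst G.connected_iff_constant_along_arcs[of origin]) (auto simp: measurement_graph_def)
  have ker: "C *\<^sub>v v = 0\<^sub>v (2 * (card Eo + card Ea)) \<longleftrightarrow> (\<forall>r<2. ?const (node_coord v r))"
    if "v \<in> carrier_vec (2 * m)" for v
    using observation_matrix_mult_eq_0_iff[OF assms that] by blast
  have "(\<forall>v\<in>carrier_vec (2 * m). C *\<^sub>v v = 0\<^sub>v (2 * (card Eo + card Ea)) \<longrightarrow> v = 0\<^sub>v (2 * m)) \<longleftrightarrow>
      (\<forall>f. f origin = 0 \<longrightarrow> ?const f \<longrightarrow> (\<forall>k\<in>agents m. f k = 0))" (is "?L \<longleftrightarrow> ?R")
  proof
    assume L: ?L
    show ?R
    proof (intro allI impI)
      fix f :: "nat \<Rightarrow> real" assume f: "f origin = 0" "?const f"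
      \<comment> \<open>Both coordinates of agent \<open>k\<close> receive the value
        \<open>f k\<close>, so one scalar function yields a vector satisfying the edge conditions in
        both coordinates.\<close>
      define v where "v = vec (2 * m) (\<lambda>c. f (c div 2 + 1))"
      have v: "v \<in> carrier_vec (2 * m)" by (simp add: v_def)
      have coord: "node_coord v r k = f k" if "r < 2" "k \<in> agents m \<union> {origin}" for r k
        using that f by (auto simp: node_coord_def v_def agents_def origin_def)
      have "?const (node_coord v r)" if r: "r < 2" for r
      proof
        fix e assume e: "e \<in> Eo \<union> Ea"
        \<comment> \<open>The identity \<open>coord\<close> is available only at nodes of the graph,
          so the ends of \<open>e\<close> must be located there first.\<close>
        then have "fst e \<in> agents m \<union> {origin}" "snd e \<in> agents m \<union> {origin}"
          using assms(1,3) by auto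
        then show "node_coord v r (fst e) = node_coord v r (snd e)"
          using coord[OF r] f(2) e by simp
      qed
      then have "v = 0\<^sub>v (2 * m)"
        using L ker v by blast
      then show "\<forall>k\<in>agents m. f k = 0"
        using eq_0_iff_node_coord[OF v] coord[of 0] by force
    qed
  next
    assume R: ?R
    show ?L
    proof (intro ballI impI)
      fix v :: "real vec" assume v: "v \<in> carrier_vec (2 * m)"
        and "C *\<^sub>v v = 0\<^sub>v (2 * (card Eo + card Ea))"
      then have "\<forall>r<2. ?const (node_coord v r)"
        using ker by blast
      moreover have "node_coord v r origin = 0" for r
        by (simp add: node_coord_def)
      \<comment> \<open>Each of the two coordinate functions of \<open>v\<close> is an admissible
        \<open>f\<close> in \<open>?R\<close>.\<close>
      ultimately show "v = 0\<^sub>v (2 * m)"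
        unfolding eq_0_iff_node_coord[OF v] using R by blast
    qed
  qed
  then show ?thesis
    unfolding conn observable_zero_system_iff[OF is_observation_matrix_carrier[OF assms(4)]] .
qed

end
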